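(* Consider the joint alignment model described in the context, and assume $k \leq n^{o(1)}$. (a) If $n^{-1/4} \leq \delta \leq \frac{1}{2k}$, then any non-adaptive, possibly randomized, query algorithm making $o\!\left(\frac{n \log n}{\delta^2 k}\right)$ queries has success probability at most $\exp(-n^{\Omega(1)})$. (b) If $\frac{1}{2k} \leq \delta \leq \frac14$, then any non-adaptive, possibly randomized, query algorithm making $o\!\left(\frac{n \log n}{\delta}\right)$ queries has success probability at most $\exp(-n^{\Omega(1)})$.
   Context: Joint alignment model: $V = [n] = \{1,\dots,n\}$ is a set of items and $g : V \to \{0,1,\dots,k-1\}$ is an unknown labeling. For a pair of distinct items $x,y$, a query returns the noisy measurement $\tilde{f}(x,y) = (g(x) - g(y) + \eta_{xy}) \bmod k$, where the noise values $\eta_{xy}$ for distinct queried pairs are i.i.d. random variables on $\{0,\dots,k-1\}$ with $\Pr[\eta_{xy}=0] = \frac1k + \delta$ and $\Pr[\eta_{xy}=i] = \frac1k - \frac{\delta}{k-1}$ for each $i \neq 0$, for a parameter $\delta > 0$. Each pair is queried at most once. A non-adaptive algorithm chooses its (possibly random) set of queried pairs before seeing any answers. The algorithm has success probability $\varepsilon$ if for every labeling $g$ it outputs, with probability at least $\varepsilon$, a labeling equal to $g$ up to a global cyclic shift, i.e. a labeling $\hat g$ with $\hat g(v) = (g(v)+\alpha) \bmod k$ for all $v$ and some $\alpha \in \{0,\dots,k-1\}$. *)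

theory Defs
  imports "HOL-Probability.Probability" "HOL-Library.Landau_Symbols"
begin

definition noise_pmf :: "nat \<Rightarrow> real \<Rightarrow> nat pmf" where
  "noise_pmf k \<delta> = embed_pmf (\<lambda>i.
     if i = 0 then 1 / real k + \<delta>
     else if i < k then 1 / real k - \<delta> / (real k - 1)
     else 0)"

text \<open>
  The underlying function of \<^const>\<open>embed_pmf\<close> is a probability mass function in the whole
  admissible range of the parameters, so \<^const>\<open>noise_pmf\<close> is the intended distribution there.
\<close>

lemma pmf_noise_pmf:
  assumes "2 \<le> k" "0 \<le> \<delta>" "\<delta> \<le> 1 - 1 / real k"
  shows "pmf (noise_pmf k \<delta>) i =
    (if i = 0 then 1 / real k + \<delta>
     else if i < k then 1 / real k - \<delta> / (real k - 1)
     else 0)"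
proof -
  define p where "p = (\<lambda>i. if i = 0 then 1 / real k + \<delta>
     else if i < k then 1 / real k - \<delta> / (real k - 1) else 0)"
  have k1: "real k - 1 > 0" using assms by simp
  have "\<delta> / (real k - 1) \<le> 1 / real k"
  proof -
    have "\<delta> \<le> (real k - 1) / real k" using assms by (simp add: diff_divide_distrib)
    then have "\<delta> / (real k - 1) \<le> ((real k - 1) / real k) / (real k - 1)"
      using k1 by (intro divide_right_mono) auto
    then show ?thesis using k1 by simp
  qed
  then have nonneg: "p j \<ge> 0" for j using assms by (simp add: p_def)
  have "(\<Sum>j<k. p j) = p 0 + (\<Sum>j\<in>{1..<k}. p j)"
    using assms by (simp add: lessThan_atLeast0 sum.atLeast_Suc_lessThan)
  also have "(\<Sum>j\<in>{1..<k}. p j) = (\<Sum>j\<in>{1..<k}. 1 / real k - \<delta> / (real k - 1))"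
    by (rule sum.cong) (auto simp: p_def)
  also have "\<dots> = (real k - 1) * (1 / real k - \<delta> / (real k - 1))"
    using assms by (simp add: of_nat_diff)
  also have "\<dots> = (real k - 1) / real k - \<delta>"
    using k1 by (simp add: right_diff_distrib)
  also have "p 0 + \<dots> = 1" using assms by (simp add: p_def diff_divide_distrib)
  finally have sum1: "(\<Sum>j<k. p j) = 1" .
  have "(\<integral>\<^sup>+j. ennreal (p j) \<partial>count_space UNIV) = (\<integral>\<^sup>+j. ennreal (p j) \<partial>count_space {..<k})"
    by (rule nn_integral_count_space_eq) (use assms in \<open>auto simp: p_def\<close>)
  also have "\<dots> = (\<Sum>j<k. ennreal (p j))" by (simp add: nn_integral_count_space_finite)
  also have "\<dots> = 1" using nonneg sum1 by (simp add: sum_ennreal)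
  finally have "pmf (embed_pmf p) i = p i" using nonneg by (intro pmf_embed_pmf) auto
  then show ?thesis by (simp add: noise_pmf_def p_def)
qed

text \<open>
  A query is an ordered pair, because the measurement depends on the orientation; but each
  unordered pair of distinct items may be queried in at most one orientation.
\<close>

definition valid_queries :: "nat \<Rightarrow> (nat \<times> nat) set \<Rightarrow> bool" where
  "valid_queries n Q \<longleftrightarrow>
     (\<forall>(x, y)\<in>Q. x \<in> {1..n} \<and> y \<in> {1..n} \<and> x \<noteq> y \<and> (y, x) \<notin> Q)"

definition measurement :: "nat \<Rightarrow> (nat \<Rightarrow> nat) \<Rightarrow> (nat \<times> nat \<Rightarrow> nat) \<Rightarrow> nat \<times> nat \<Rightarrow> nat" where
  "measurement k g \<eta> = (\<lambda>(x, y). nat ((int (g x) - int (g y) + int (\<eta> (x, y))) mod int k))"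

text \<open>
  The restriction to the queried pairs is essential: outside of them the measurement function
  would reveal label differences without noise.
\<close>

definition answers_pmf :: "nat \<Rightarrow> real \<Rightarrow> (nat \<Rightarrow> nat) \<Rightarrow> (nat \<times> nat) set \<Rightarrow> (nat \<times> nat \<Rightarrow> nat) pmf" where
  "answers_pmf k \<delta> g Q =
     map_pmf (\<lambda>\<eta>. restrict (measurement k g \<eta>) Q) (Pi_pmf Q 0 (\<lambda>_. noise_pmf k \<delta>))"

text \<open>
  A randomized non-adaptive algorithm draws its set of queries independently of the answers; the
  output is then drawn from a distribution depending on the chosen queries and their answers.
  Internal randomness shared by the two phases is covered by conditioning on the chosen queries.
\<close>

record nonadaptive_algorithm =
  query_dist :: "(nat \<times> nat) set pmf"
  decoder :: "(nat \<times> nat) set \<Rightarrow> (nat \<times> nat \<Rightarrow> nat) \<Rightarrow> (nat \<Rightarrow> nat) pmf"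

definition makes_at_most_queries :: "nat \<Rightarrow> nonadaptive_algorithm \<Rightarrow> nat \<Rightarrow> bool" where
  "makes_at_most_queries n A m \<longleftrightarrow>
     (\<forall>Q \<in> set_pmf (query_dist A). valid_queries n Q \<and> card Q \<le> m)"

definition output_pmf :: "nat \<Rightarrow> real \<Rightarrow> nonadaptive_algorithm \<Rightarrow> (nat \<Rightarrow> nat) \<Rightarrow> (nat \<Rightarrow> nat) pmf" where
  "output_pmf k \<delta> A g =
     bind_pmf (query_dist A) (\<lambda>Q. bind_pmf (answers_pmf k \<delta> g Q) (\<lambda>f. decoder A Q f))"

definition equal_up_to_shift :: "nat \<Rightarrow> nat \<Rightarrow> (nat \<Rightarrow> nat) \<Rightarrow> (nat \<Rightarrow> nat) \<Rightarrow> bool" where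
  "equal_up_to_shift n k g h \<longleftrightarrow> (\<exists>\<alpha><k. \<forall>v\<in>{1..n}. h v = (g v + \<alpha>) mod k)"

definition has_success_probability :: "nat \<Rightarrow> nat \<Rightarrow> real \<Rightarrow> nonadaptive_algorithm \<Rightarrow> real \<Rightarrow> bool" where
  "has_success_probability n k \<delta> A \<epsilon> \<longleftrightarrow>
     (\<forall>g \<in> {1..n} \<rightarrow> {..<k}.
        measure_pmf.prob (output_pmf k \<delta> A g) {h. equal_up_to_shift n k g h} \<ge> \<epsilon>)"

end

theory Submission
  imports Defs "HOL-Real_Asymp.Real_Asymp"
begin

text \<open>
  Put the uniform prior on labelings with values in \<open>{0, 1}\<close> and fix a set \<open>Q\<close> of at most \<open>m\<close>
  queries. If \<open>D \<ge> 4 m / n\<close>, then at least half of the items have degree at most \<open>D\<close> in the query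
  graph, and a maximal independent set \<open>S\<close> among them satisfies \<open>|S| (D + 1) \<ge> n / 2\<close>. Once the
  labels outside \<open>S\<close> are revealed, recovering the labeling means solving \<open>|S|\<close> independent binary
  tests, each based on at most \<open>D\<close> samples of the noise. If \<open>H\<close> is the squared Hellinger distance
  between the noise and a shifted copy, then by Le Cam's inequality each test succeeds with
  probability at most \<open>(1 + sqrt (1 - (1 - H)^(2 D))) / 2 \<le> exp (- exp (- 4 H D) / 4)\<close>. The two
  regimes correspond to the bounds \<open>H \<le> 2 r\<close> with \<open>r = \<delta>\<^sup>2 k\<close> and \<open>r = \<delta>\<close>. Since \<open>m r = o(n log n)\<close>,
  one can take \<open>D\<close> to be a small multiple of \<open>log n / r\<close>; then a test fails with probability at
  least \<open>n^(-1/16) / 4\<close>, while \<open>r \<ge> n^(-1/2) / 2\<close> makes \<open>|S|\<close> at least \<open>n^(1/2 - o(1))\<close>. Hence all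
  tests succeed with probability at most \<open>exp (- n^(1/4))\<close>, even after a union bound over the \<open>k\<close>
  global shifts.
\<close>

subsection \<open>Elementary estimates\<close>

lemma exp_neg_double_le:
  fixes h :: real
  assumes "0 \<le> h" "h \<le> 1 / 2"
  shows "exp (- (2 * h)) \<le> 1 - h"
proof -
  have "- (2 * h) \<le> - h - 2 * h\<^sup>2"
    using assms mult_left_mono[of "2 * h" 1 h] by (simp add: power2_eq_square)
  also have "\<dots> \<le> ln (1 - h)"
    using assms by (rule ln_one_minus_pos_lower_bound)
  finally show ?thesis
    using assms(2) by (simp add: ln_ge_iff)
qed

lemma exp_neg_le_one_minus_power:
  fixes h x :: real
  assumes "0 \<le> h" "h \<le> 1 / 2" "real j \<le> x"
  shows "exp (- (2 * h * x)) \<le> (1 - h) ^ j"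
proof -
  have "exp (- (2 * h * x)) \<le> exp (- (2 * h * real j))"
    using assms by (simp add: mult_left_mono)
  also have "\<dots> = exp (- (2 * h)) ^ j"
    by (simp flip: exp_of_nat_mult add: mult_ac)
  also have "\<dots> \<le> (1 - h) ^ j"
    using exp_neg_double_le[OF assms(1,2)] by (intro power_mono) auto
  finally show ?thesis .
qed

lemma half_one_plus_sqrt_le_exp:
  fixes x y :: real
  assumes "y \<le> x" "x \<le> 1"
  shows "(1 + sqrt (1 - x)) / 2 \<le> exp (- (y / 4))"
proof -
  have "sqrt (1 - x) \<le> 1 - x / 2"
    using assms by (intro real_le_lsqrt) (auto simp: power2_eq_square algebra_simps)
  then have "(1 + sqrt (1 - x)) / 2 \<le> 1 + - (y / 4)"
    using assms by simp
  also have "\<dots> \<le> exp (- (y / 4))"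
    by (rule exp_ge_add_one_self)
  finally show ?thesis .
qed

lemma prod_half_one_plus_sqrt_le_exp:
  fixes h x :: real and j :: "'a \<Rightarrow> nat"
  assumes h: "0 \<le> h" "h \<le> 1 / 2" and j: "\<And>v. v \<in> S \<Longrightarrow> real (j v) \<le> x"
  shows "(\<Prod>v\<in>S. (1 + sqrt (1 - (1 - h) ^ (2 * j v))) / 2)
    \<le> exp (- (real (card S) / 4 * exp (- (4 * h * x))))"
proof -
  have power_ge: "exp (- (4 * h * x)) \<le> (1 - h) ^ (2 * j v)" if "v \<in> S" for v
    using exp_neg_le_one_minus_power[OF h, of "2 * j v" "2 * x"] j[OF that] by (simp add: mult_ac)
  have power_le_1: "(1 - h) ^ i \<le> 1" for i
    using h by (intro power_le_one) auto
  have "(\<Prod>v\<in>S. (1 + sqrt (1 - (1 - h) ^ (2 * j v))) / 2)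
      \<le> (\<Prod>v\<in>S. exp (- (exp (- (4 * h * x)) / 4)))"
    using power_ge power_le_1
    by (intro prod_mono conjI half_one_plus_sqrt_le_exp) (auto intro: add_nonneg_nonneg)
  also have "\<dots> = exp (- (real (card S) / 4 * exp (- (4 * h * x))))"
    by (simp flip: exp_of_nat_mult)
  finally show ?thesis .
qed

lemma eventually_powr_le_powr:
  assumes "e \<in> o(\<lambda>_. 1)" "0 < c"
  shows "\<forall>\<^sub>F n :: nat in sequentially. real n powr e n \<le> real n powr c"
proof -
  have "\<forall>\<^sub>F n in sequentially. norm (e n) \<le> c * norm (1 :: real)"
    using assms by (rule landau_o.smallD)
  then show ?thesis using eventually_gt_at_top[of 0]
  proof eventually_elim
    case (elim n)
    then show ?case by (intro powr_mono) auto
  qed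
qed

subsection \<open>Sums over dependent products\<close>

lemma prod_sum_PiE_fibres:
  fixes F :: "'i \<Rightarrow> ('a \<Rightarrow> 'b) \<Rightarrow> 'c :: comm_semiring_1"
  assumes fin: "finite A" "finite I" "\<And>x. x \<in> A \<Longrightarrow> finite (K x)" and owner: "\<pi> \<in> A \<rightarrow> I"
    and local: "\<And>i f. i \<in> I \<Longrightarrow> F i (restrict f {x \<in> A. \<pi> x = i}) = F i f"
  shows "(\<Prod>i\<in>I. \<Sum>f\<in>PiE {x \<in> A. \<pi> x = i} K. F i f) = (\<Sum>f\<in>PiE A K. \<Prod>i\<in>I. F i f)"
proof -
  let ?A = "\<lambda>i. {x \<in> A. \<pi> x = i}"
  have "(\<Prod>i\<in>I. \<Sum>f\<in>PiE (?A i) K. F i f) = (\<Sum>h\<in>PiE I (\<lambda>i. PiE (?A i) K). \<Prod>i\<in>I. F i (h i))"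
    using fin by (intro prod_sum_PiE finite_PiE) auto
  also have "\<dots> = (\<Sum>f\<in>PiE A K. \<Prod>i\<in>I. F i f)"
  proof (rule sum.reindex_bij_witness[where
        j = "\<lambda>h. \<lambda>x\<in>A. h (\<pi> x) x" and i = "\<lambda>f. \<lambda>i\<in>I. restrict f (?A i)"])
    fix h assume h: "h \<in> PiE I (\<lambda>i. PiE (?A i) K)"
    have restrict_eq: "restrict (\<lambda>x\<in>A. h (\<pi> x) x) (?A i) = h i" if "i \<in> I" for i
      using PiE_mem[OF h that] by (auto simp: fun_eq_iff restrict_def PiE_def extensional_def)
    then show "(\<lambda>i\<in>I. restrict (\<lambda>x\<in>A. h (\<pi> x) x) (?A i)) = h"
      using PiE_restrict[OF h] by (metis (no_types, lifting) restrict_ext)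
    show "(\<lambda>x\<in>A. h (\<pi> x) x) \<in> PiE A K"
      using h owner by (fastforce simp: PiE_iff Pi_iff)
    show "(\<Prod>i\<in>I. F i (\<lambda>x\<in>A. h (\<pi> x) x)) = (\<Prod>i\<in>I. F i (h i))"
      using restrict_eq local by (intro prod.cong refl) metis
  next
    fix f assume f: "f \<in> PiE A K"
    then show "(\<lambda>x\<in>A. (\<lambda>i\<in>I. restrict f (?A i)) (\<pi> x) x) = f"
      using owner by (auto simp: fun_eq_iff restrict_def PiE_def extensional_def)
    show "(\<lambda>i\<in>I. restrict f (?A i)) \<in> PiE I (\<lambda>i. PiE (?A i) K)"
      using f by (auto simp: Pi_iff)
  qed
  finally show ?thesis .
qed

lemma sum_PiE_split:
  assumes "finite V" "\<And>v. v \<in> V \<Longrightarrow> finite (K v)" "T \<subseteq> V"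
  shows "(\<Sum>g\<in>PiE V K. F g) = (\<Sum>u\<in>PiE T K. \<Sum>g\<in>PiE V (\<lambda>v. if v \<in> T then {u v} else K v). F g)"
proof -
  have "{g \<in> PiE V K. restrict g T = u} = PiE V (\<lambda>v. if v \<in> T then {u v} else K v)" (is "?L = ?R")
    if u: "u \<in> PiE T K" for u
  proof (intro set_eqI iffI)
    fix g assume "g \<in> ?L"
    then show "g \<in> ?R" by (auto simp: PiE_iff)
  next
    fix g assume g: "g \<in> ?R"
    have "g v \<in> K v" if "v \<in> V" for v
      using PiE_mem[OF g that] PiE_mem[OF u, of v] by (auto split: if_splits)
    moreover have "restrict g T v = u v" for v
      using PiE_mem[OF g, of v] PiE_arb[OF u, of v] \<open>T \<subseteq> V\<close> by (auto simp: restrict_def)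
    ultimately show "g \<in> ?L" using g by (auto simp: PiE_iff)
  qed
  moreover have "finite (PiE V K)" "finite (PiE T K)"
    using assms finite_subset[OF assms(3,1)] by (auto intro!: finite_PiE)
  moreover have "(\<lambda>g. restrict g T) ` PiE V K \<subseteq> PiE T K" using \<open>T \<subseteq> V\<close> by auto
  ultimately show ?thesis by (simp flip: sum.group[of "PiE V K" "PiE T K" "\<lambda>g. restrict g T" F])
qed

subsection \<open>Guessing a parameter from a sample\<close>

lemma prob_bind_pmf:
  "measure_pmf.prob (bind_pmf p f) A = measure_pmf.expectation p (\<lambda>x. measure_pmf.prob (f x) A)"
  unfolding measure_pmf_bind
  by (rule measure_pmf.measure_bind[where N = "count_space UNIV"])
     (auto simp: space_subprob_algebra intro: prob_space_imp_subprob_space prob_space_measure_pmf)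

lemma sum_prob_le_multiplicity:
  assumes "finite G" and "\<And>h. card {g \<in> G. h \<in> H g} \<le> m"
  shows "(\<Sum>g\<in>G. measure_pmf.prob p (H g)) \<le> real m"
proof -
  have "(\<Sum>g\<in>G. measure_pmf.prob p (H g)) = (\<Sum>g\<in>G. measure_pmf.expectation p (indicator (H g)))"
    by simp
  also have "\<dots> = measure_pmf.expectation p (\<lambda>h. \<Sum>g\<in>G. indicator (H g) h)"
    by (intro Bochner_Integration.integral_sum[symmetric]
          measure_pmf.integrable_const_bound[where B = 1]) auto
  also have "\<dots> = measure_pmf.expectation p (\<lambda>h. real (card {g \<in> G. h \<in> H g}))"
    using assms(1) by (simp add: indicator_def sum.If_cases Int_def)
  also have "\<dots> \<le> real m"
    using assms(2)
    by (intro measure_pmf.integral_le_const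
          measure_pmf.integrable_const_bound[where B = "real m"]) auto
  finally show ?thesis .
qed

lemma sum_prob_bind_pmf_le:
  assumes "finite G" and card_le: "\<And>h. card {g \<in> G. h \<in> H g} \<le> m"
    and "finite X" and supp: "\<And>g. g \<in> G \<Longrightarrow> set_pmf (P g) \<subseteq> X"
    and dominated: "\<And>g x. g \<in> G \<Longrightarrow> x \<in> X \<Longrightarrow> pmf (P g) x \<le> M x" "\<And>x. x \<in> X \<Longrightarrow> 0 \<le> M x"
  shows "(\<Sum>g\<in>G. measure_pmf.prob (bind_pmf (P g) D) (H g)) \<le> real m * (\<Sum>x\<in>X. M x)"
proof -
  have "measure_pmf.prob (bind_pmf (P g) D) (H g) =
      (\<Sum>x\<in>X. pmf (P g) x * measure_pmf.prob (D x) (H g))"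
    if "g \<in> G" for g
    unfolding prob_bind_pmf using \<open>finite X\<close> supp[OF that]
    by (subst integral_measure_pmf[where A = X]) auto
  then have "(\<Sum>g\<in>G. measure_pmf.prob (bind_pmf (P g) D) (H g)) =
      (\<Sum>g\<in>G. \<Sum>x\<in>X. pmf (P g) x * measure_pmf.prob (D x) (H g))"
    by simp
  also have "\<dots> \<le> (\<Sum>g\<in>G. \<Sum>x\<in>X. M x * measure_pmf.prob (D x) (H g))"
    using dominated(1) by (intro sum_mono mult_right_mono) auto
  also have "\<dots> = (\<Sum>x\<in>X. M x * (\<Sum>g\<in>G. measure_pmf.prob (D x) (H g)))"
    by (subst sum.swap) (simp add: sum_distrib_left)
  also have "\<dots> \<le> (\<Sum>x\<in>X. M x * real m)"
    using dominated(2) assms(1) card_le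
    by (intro sum_mono mult_left_mono sum_prob_le_multiplicity) auto
  finally show ?thesis
    by (simp add: sum_distrib_left mult.commute)
qed

subsection \<open>The Bhattacharyya coefficient\<close>

definition bhattacharyya :: "'a set \<Rightarrow> ('a \<Rightarrow> real) \<Rightarrow> ('a \<Rightarrow> real) \<Rightarrow> real" where
  "bhattacharyya X p q = (\<Sum>x\<in>X. sqrt (p x * q x))"

lemma bhattacharyya_self:
  assumes "\<And>x. x \<in> X \<Longrightarrow> 0 \<le> p x"
  shows "bhattacharyya X p p = sum p X"
  unfolding bhattacharyya_def using assms by (intro sum.cong) auto

lemma bhattacharyya_PiE:
  assumes "finite B" "\<And>e. e \<in> B \<Longrightarrow> finite (K e)"
  shows "bhattacharyya (PiE B K) (\<lambda>f. \<Prod>e\<in>B. p e (f e)) (\<lambda>f. \<Prod>e\<in>B. q e (f e)) =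
    (\<Prod>e\<in>B. bhattacharyya (K e) (p e) (q e))"
proof -
  have "sqrt (\<Prod>e\<in>B. r e) = (\<Prod>e\<in>B. sqrt (r e))" for r :: "'a \<Rightarrow> real"
    by (induction B rule: infinite_finite_induct) (auto simp: real_sqrt_mult)
  then show ?thesis
    using assms by (simp add: bhattacharyya_def prod_sum_PiE flip: prod.distrib)
qed

text \<open>Le Cam's inequality: the total variation distance is \<open>\<Sum>x\<in>X. max (p x) (q x) - 1\<close>.\<close>

lemma sum_max_le_bhattacharyya:
  fixes p q :: "'a \<Rightarrow> real"
  assumes "\<And>x. x \<in> X \<Longrightarrow> 0 \<le> p x" "\<And>x. x \<in> X \<Longrightarrow> 0 \<le> q x" and "sum p X = 1" "sum q X = 1"
  shows "(\<Sum>x\<in>X. max (p x) (q x)) \<le> 1 + sqrt (1 - (bhattacharyya X p q)\<^sup>2)"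
proof -
  define t where "t = (\<Sum>x\<in>X. max (p x) (q x))"
  have "t + (\<Sum>x\<in>X. min (p x) (q x)) = (\<Sum>x\<in>X. p x + q x)"
    unfolding t_def sum.distrib[symmetric] by (intro sum.cong) auto
  then have sum_min: "(\<Sum>x\<in>X. min (p x) (q x)) = 2 - t"
    using assms by (simp add: sum.distrib)
  have "(bhattacharyya X p q)\<^sup>2 = (\<Sum>x\<in>X. sqrt (min (p x) (q x)) * sqrt (max (p x) (q x)))\<^sup>2"
    unfolding bhattacharyya_def
    by (intro arg_cong[where f = "\<lambda>x. x\<^sup>2"] sum.cong) (auto simp: real_sqrt_mult min_def max_def)
  also have "\<dots> \<le> (\<Sum>x\<in>X. (sqrt (min (p x) (q x)))\<^sup>2) * (\<Sum>x\<in>X. (sqrt (max (p x) (q x)))\<^sup>2)"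
    by (rule Cauchy_Schwarz_ineq_sum)
  also have "\<dots> = (\<Sum>x\<in>X. min (p x) (q x)) * (\<Sum>x\<in>X. max (p x) (q x))"
    using assms by (intro arg_cong2[where f = "(*)"] sum.cong) (auto simp: min_def max_def)
  also have "\<dots> = 1 - (t - 1)\<^sup>2"
    unfolding sum_min by (simp add: t_def power2_eq_square algebra_simps)
  finally have "t - 1 \<le> sqrt (1 - (bhattacharyya X p q)\<^sup>2)"
    by (intro real_le_rsqrt) simp
  then show ?thesis by (simp add: t_def)
qed

lemma sum_max_prod_pmf_le:
  fixes p q :: "'a \<Rightarrow> 'b pmf"
  assumes "finite B" "\<And>e. e \<in> B \<Longrightarrow> finite (K e)"
    and "\<And>e. e \<in> B \<Longrightarrow> set_pmf (p e) \<subseteq> K e" "\<And>e. e \<in> B \<Longrightarrow> set_pmf (q e) \<subseteq> K e"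
  shows "(\<Sum>f\<in>PiE B K. max (\<Prod>e\<in>B. pmf (p e) (f e)) (\<Prod>e\<in>B. pmf (q e) (f e)))
    \<le> 1 + sqrt (1 - (\<Prod>e\<in>B. bhattacharyya (K e) (pmf (p e)) (pmf (q e)))\<^sup>2)"
proof -
  have "(\<Sum>f\<in>PiE B K. \<Prod>e\<in>B. pmf (r e) (f e)) = 1"
    if "\<And>e. e \<in> B \<Longrightarrow> set_pmf (r e) \<subseteq> K e" for r :: "'a \<Rightarrow> 'b pmf"
    using assms(1,2) that by (subst prod_sum_PiE[symmetric]) (simp_all add: sum_pmf_eq_1)
  then show ?thesis
    using bhattacharyya_PiE[OF assms(1,2), where p = "\<lambda>e. pmf (p e)" and q = "\<lambda>e. pmf (q e)"]
      assms(3,4)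
      sum_max_le_bhattacharyya[of "PiE B K" "\<lambda>f. \<Prod>e\<in>B. pmf (p e) (f e)" "\<lambda>f. \<Prod>e\<in>B. pmf (q e) (f e)"]
    by (simp add: prod_nonneg)
qed

lemma sum_prod_max_pmf_le:
  fixes p q :: "'a \<Rightarrow> 'b pmf"
  assumes fin: "finite A" "finite I" "\<And>e. e \<in> A \<Longrightarrow> finite (K e)" and owner: "\<pi> \<in> A \<rightarrow> I"
    and supp: "\<And>e. e \<in> A \<Longrightarrow> set_pmf (p e) \<subseteq> K e" "\<And>e. e \<in> A \<Longrightarrow> set_pmf (q e) \<subseteq> K e"
  shows "(\<Sum>f\<in>PiE A K. \<Prod>i\<in>I.
            max (\<Prod>e | e \<in> A \<and> \<pi> e = i. pmf (p e) (f e)) (\<Prod>e | e \<in> A \<and> \<pi> e = i. pmf (q e) (f e)))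
    \<le> (\<Prod>i\<in>I. 1 + sqrt (1 - (\<Prod>e | e \<in> A \<and> \<pi> e = i. bhattacharyya (K e) (pmf (p e)) (pmf (q e)))\<^sup>2))"
proof -
  let ?A = "\<lambda>i. {e \<in> A. \<pi> e = i}"
  let ?X = "\<lambda>i f. max (\<Prod>e\<in>?A i. pmf (p e) (f e)) (\<Prod>e\<in>?A i. pmf (q e) (f e))"
  have "?X i (restrict f (?A i)) = ?X i f" for i f
    by (intro arg_cong2[where f = max] prod.cong) auto
  then have "(\<Sum>f\<in>PiE A K. \<Prod>i\<in>I. ?X i f) = (\<Prod>i\<in>I. \<Sum>f\<in>PiE (?A i) K. ?X i f)"
    by (intro prod_sum_PiE_fibres[symmetric] fin owner)
  also have "\<dots> \<le> (\<Prod>i\<in>I. 1 + sqrt (1 - (\<Prod>e\<in>?A i. bhattacharyya (K e) (pmf (p e)) (pmf (q e)))\<^sup>2))"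
  proof (intro prod_mono conjI sum_max_prod_pmf_le)
    show "0 \<le> (\<Sum>f\<in>PiE (?A i) K. ?X i f)" for i
      by (intro sum_nonneg max.coboundedI1 prod_nonneg) simp
  qed (use fin supp in auto)
  finally show ?thesis .
qed

subsection \<open>Independent sets of low degree\<close>

definition incident :: "('a \<times> 'a) set \<Rightarrow> 'a \<Rightarrow> ('a \<times> 'a) set" where
  "incident Q v = {e \<in> Q. fst e = v \<or> snd e = v}"

definition independent_set :: "('a \<times> 'a) set \<Rightarrow> 'a set \<Rightarrow> bool" where
  "independent_set Q S \<longleftrightarrow> Q \<inter> S \<times> S = {}"

lemma finite_incident: "finite Q \<Longrightarrow> finite (incident Q v)"
  by (simp add: incident_def)

lemma sum_card_incident_le:
  assumes "finite Q" "finite V"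
  shows "(\<Sum>v\<in>V. card (incident Q v)) \<le> 2 * card Q"
proof -
  have "(\<Sum>v\<in>V. card (incident Q v)) = (\<Sum>v\<in>V. \<Sum>e\<in>Q. if fst e = v \<or> snd e = v then 1 else 0)"
    using assms by (simp add: incident_def sum.If_cases Int_def)
  also have "\<dots> = (\<Sum>e\<in>Q. \<Sum>v\<in>V. if fst e = v \<or> snd e = v then 1 else 0)"
    by (rule sum.swap)
  also have "\<dots> \<le> (\<Sum>e\<in>Q. 2)"
  proof (rule sum_mono)
    fix e assume "e \<in> Q"
    have "card {v \<in> V. fst e = v \<or> snd e = v} \<le> card {fst e, snd e}"
      by (intro card_mono) auto
    also have "\<dots> \<le> 2" by (simp add: card_insert_if)
    finally show "(\<Sum>v\<in>V. if fst e = v \<or> snd e = v then 1 else 0) \<le> (2 :: nat)"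
      using assms by (simp add: sum.If_cases Int_def)
  qed
  finally show ?thesis by simp
qed

lemma card_low_degree_ge:
  assumes "finite Q" "finite V" and "0 < D" "4 * real (card Q) \<le> real (card V) * D"
  shows "real (card V) \<le> 2 * real (card {v \<in> V. real (card (incident Q v)) \<le> D})"
proof -
  let ?low = "{v \<in> V. real (card (incident Q v)) \<le> D}"
  have "real (card (V - ?low)) * D = (\<Sum>v\<in>V - ?low. D)" by simp
  also have "\<dots> \<le> (\<Sum>v\<in>V - ?low. real (card (incident Q v)))"
    by (intro sum_mono) auto
  also have "\<dots> \<le> 2 * real (card Q)"
    using sum_card_incident_le[OF assms(1), of "V - ?low"] assms(2) by (simp flip: of_nat_sum)
  also have "\<dots> \<le> real (card V) / 2 * D" using assms(4) by simp
  finally have "real (card (V - ?low)) \<le> real (card V) / 2"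
    using \<open>0 < D\<close> by simp
  moreover have "card V = card ?low + card (V - ?low)"
    using assms(2) by (subst card_Un_disjoint[symmetric]) (auto intro: arg_cong[where f = card])
  ultimately show ?thesis by simp
qed

definition closed_neighbourhood :: "('a \<times> 'a) set \<Rightarrow> 'a \<Rightarrow> 'a set" where
  "closed_neighbourhood Q v = insert v (Q `` {v} \<union> Q\<inverse> `` {v})"

lemma closed_neighbourhood_subset:
  "closed_neighbourhood Q v \<subseteq> insert v ((\<lambda>e. if fst e = v then snd e else fst e) ` incident Q v)"
proof
  fix w assume "w \<in> closed_neighbourhood Q v"
  then consider "w = v" | "(v, w) \<in> Q" | "w \<noteq> v" "(w, v) \<in> Q"
    by (auto simp: closed_neighbourhood_def)
  then show "w \<in> insert v ((\<lambda>e. if fst e = v then snd e else fst e) ` incident Q v)"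
    by cases (auto simp: incident_def image_iff intro: bexI[of _ "(v, w)"] bexI[of _ "(w, v)"])
qed

lemma finite_closed_neighbourhood: "finite Q \<Longrightarrow> finite (closed_neighbourhood Q v)"
  by (rule finite_subset[OF closed_neighbourhood_subset]) (simp add: finite_incident)

lemma card_closed_neighbourhood_le:
  assumes "finite Q"
  shows "card (closed_neighbourhood Q v) \<le> Suc (card (incident Q v))"
proof -
  have "card (insert v (f ` incident Q v)) \<le> Suc (card (incident Q v))" for f
    using finite_incident[OF assms] card_image_le[OF finite_incident[OF assms], of f]
    by (simp add: card_insert_if le_SucI)
  from order_trans[OF card_mono[OF _ closed_neighbourhood_subset] this] show ?thesis
    using finite_incident[OF assms] by blast
qed

lemma ex_dominating_independent_set:
  assumes "irrefl Q" "finite T"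
  obtains S where "S \<subseteq> T" "independent_set Q S" "T \<subseteq> (\<Union>v\<in>S. closed_neighbourhood Q v)"
proof -
  let ?\<S> = "{S. S \<subseteq> T \<and> independent_set Q S}"
  have "finite ?\<S>" by (rule finite_subset[of _ "Pow T"]) (use assms(2) in auto)
  moreover have "{} \<in> ?\<S>" by (simp add: independent_set_def)
  ultimately obtain S where S: "S \<subseteq> T" "independent_set Q S"
    and maximal: "\<forall>S'\<in>?\<S>. S \<subseteq> S' \<longrightarrow> S = S'"
    using finite_has_maximal[of ?\<S>] by (metis (mono_tags, lifting) empty_iff mem_Collect_eq)
  have "w \<in> (\<Union>v\<in>S. closed_neighbourhood Q v)" if "w \<in> T" for w
  proof (cases "w \<in> S")
    case True
    then show ?thesis by (auto simp: closed_neighbourhood_def)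
  next
    case False
    then have "\<not> independent_set Q (insert w S)"
      using bspec[OF maximal, of "insert w S"] S(1) \<open>w \<in> T\<close> by auto
    then obtain v where "v \<in> S" "(w, v) \<in> Q \<or> (v, w) \<in> Q"
      using S(2) \<open>irrefl Q\<close> by (auto simp: independent_set_def irrefl_def)
    then show ?thesis by (auto simp: closed_neighbourhood_def)
  qed
  then show thesis by (intro that[OF S] subsetI)
qed

lemma ex_large_independent_set:
  assumes "finite Q" "irrefl Q" "finite T" and degree: "\<And>v. v \<in> T \<Longrightarrow> real (card (incident Q v)) \<le> D"
  obtains S where "S \<subseteq> T" "independent_set Q S" "real (card T) \<le> real (card S) * (D + 1)"
proof -
  obtain S where S: "S \<subseteq> T" "independent_set Q S"
    and dominating: "T \<subseteq> (\<Union>v\<in>S. closed_neighbourhood Q v)"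
    using ex_dominating_independent_set[OF assms(2,3)] .
  have "finite S" using S(1) assms(3) by (rule finite_subset)
  have "card T \<le> card (\<Union>v\<in>S. closed_neighbourhood Q v)"
    using \<open>finite S\<close>
    by (intro card_mono[OF _ dominating] finite_UN_I finite_closed_neighbourhood assms(1))
  also have "\<dots> \<le> (\<Sum>v\<in>S. card (closed_neighbourhood Q v))"
    using \<open>finite S\<close> by (rule card_UN_le)
  also have "\<dots> \<le> (\<Sum>v\<in>S. card (incident Q v) + 1)"
    using card_closed_neighbourhood_le[OF assms(1)] by (intro sum_mono) simp
  finally have "real (card T) \<le> real (\<Sum>v\<in>S. card (incident Q v) + 1)"
    by (rule of_nat_mono)
  also have "\<dots> \<le> (\<Sum>v\<in>S. D + 1)"
    unfolding of_nat_sum using degree S(1) by (intro sum_mono) auto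
  also have "\<dots> = real (card S) * (D + 1)" by simp
  finally show thesis using S that by blast
qed

subsection \<open>The noise and the distribution of the answers\<close>

definition hit_prob :: "nat \<Rightarrow> real \<Rightarrow> real" where
  "hit_prob k \<delta> = 1 / real k + \<delta>"

definition miss_prob :: "nat \<Rightarrow> real \<Rightarrow> real" where
  "miss_prob k \<delta> = 1 / real k - \<delta> / (real k - 1)"

text \<open>The squared Hellinger distance between the noise and any of its nontrivial cyclic shifts.\<close>

definition noise_hellinger :: "nat \<Rightarrow> real \<Rightarrow> real" where
  "noise_hellinger k \<delta> = (sqrt (hit_prob k \<delta>) - sqrt (miss_prob k \<delta>))\<^sup>2"

lemma noise_hellinger_nonneg: "0 \<le> noise_hellinger k \<delta>"
  by (simp add: noise_hellinger_def)

definition guess_bound :: "nat \<Rightarrow> real \<Rightarrow> nat \<Rightarrow> real" where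
  "guess_bound k \<delta> j = (1 + sqrt (1 - (1 - noise_hellinger k \<delta>) ^ (2 * j))) / 2"

definition label_diff :: "('a \<Rightarrow> nat) \<Rightarrow> 'a \<times> 'a \<Rightarrow> int" where
  "label_diff g e = int (g (fst e)) - int (g (snd e))"

definition answer_pmf :: "nat \<Rightarrow> real \<Rightarrow> (nat \<Rightarrow> nat) \<Rightarrow> nat \<times> nat \<Rightarrow> nat pmf" where
  "answer_pmf k \<delta> g e = map_pmf (\<lambda>\<eta>. measurement k g (\<lambda>_. \<eta>) e) (noise_pmf k \<delta>)"

lemma measurement_eq_label_diff:
  "measurement k g \<eta> e = nat ((label_diff g e + int (\<eta> e)) mod int k)"
  by (simp add: measurement_def label_diff_def case_prod_beta)

lemma answer_pmf_cong:
  assumes "g (fst e) = g' (fst e)" "g (snd e) = g' (snd e)"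
  shows "answer_pmf k \<delta> g e = answer_pmf k \<delta> g' e"
  using assms by (simp add: answer_pmf_def measurement_eq_label_diff label_diff_def)

lemma answers_pmf_eq_Pi_pmf:
  assumes "finite Q"
  shows "answers_pmf k \<delta> g Q = Pi_pmf Q undefined (answer_pmf k \<delta> g)"
proof -
  have "Pi_pmf Q undefined (answer_pmf k \<delta> g) =
      Pi_pmf Q undefined
        (\<lambda>e. bind_pmf (noise_pmf k \<delta>) (\<lambda>\<eta>. return_pmf (measurement k g (\<lambda>_. \<eta>) e)))"
    by (intro Pi_pmf_cong) (simp_all add: answer_pmf_def map_pmf_def)
  also have "\<dots> = bind_pmf (Pi_pmf Q 0 (\<lambda>_. noise_pmf k \<delta>))
      (\<lambda>\<eta>. return_pmf (restrict (measurement k g \<eta>) Q))"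
    using assms
    by (simp add: Pi_pmf_bind[where d' = 0] measurement_eq_label_diff restrict_def cong: if_cong)
  finally show ?thesis by (simp add: answers_pmf_def map_pmf_def)
qed

locale alignment_noise =
  fixes k :: nat and \<delta> :: real
  assumes k_ge_2: "2 \<le> k" and bias_nonneg: "0 \<le> \<delta>" and bias_le: "\<delta> \<le> 1 - 1 / real k"
begin

lemma miss_prob_nonneg: "0 \<le> miss_prob k \<delta>"
proof -
  have "\<delta> / (real k - 1) \<le> (1 - 1 / real k) / (real k - 1)"
    using k_ge_2 bias_le by (intro divide_right_mono) auto
  also have "\<dots> = 1 / real k"
    using k_ge_2 by (simp add: divide_simps)
  finally show ?thesis by (simp add: miss_prob_def)
qed

lemma miss_prob_le_hit_prob: "miss_prob k \<delta> \<le> hit_prob k \<delta>"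
proof -
  have "0 \<le> \<delta> / (real k - 1)" using k_ge_2 bias_nonneg by simp
  then show ?thesis using bias_nonneg by (simp add: miss_prob_def hit_prob_def)
qed

lemma hit_prob_add_miss_probs: "hit_prob k \<delta> + (real k - 1) * miss_prob k \<delta> = 1"
  using k_ge_2 by (simp add: hit_prob_def miss_prob_def field_simps)

lemma bias_div_le: "\<delta> / (real k - 1) \<le> \<delta>"
  using k_ge_2 bias_nonneg divide_left_mono[of 1 "real k - 1" \<delta>] by simp

lemma hit_prob_diff_miss_prob_le: "hit_prob k \<delta> - miss_prob k \<delta> \<le> 2 * \<delta>"
  using bias_div_le by (simp add: hit_prob_def miss_prob_def)

lemma noise_hellinger_le_bias: "noise_hellinger k \<delta> \<le> 2 * \<delta>"
proof -
  let ?p = "sqrt (hit_prob k \<delta>)" and ?r = "sqrt (miss_prob k \<delta>)"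
  have "noise_hellinger k \<delta> \<le> (?p - ?r) * (?p + ?r)"
    unfolding noise_hellinger_def power2_eq_square
    using miss_prob_le_hit_prob miss_prob_nonneg by (intro mult_left_mono) auto
  also have "\<dots> = hit_prob k \<delta> - miss_prob k \<delta>"
    using miss_prob_le_hit_prob miss_prob_nonneg by (simp add: algebra_simps)
  also have "\<dots> \<le> 2 * \<delta>"
    by (rule hit_prob_diff_miss_prob_le)
  finally show ?thesis .
qed

lemma noise_hellinger_le_bias_squared: "noise_hellinger k \<delta> \<le> 2 * (\<delta>\<^sup>2 * real k)"
proof -
  let ?p = "sqrt (hit_prob k \<delta>)" and ?r = "sqrt (miss_prob k \<delta>)"
  have sqrt_sq: "?p\<^sup>2 = hit_prob k \<delta>" "?r\<^sup>2 = miss_prob k \<delta>"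
    using miss_prob_le_hit_prob miss_prob_nonneg by simp_all
  have "2 / real k \<le> hit_prob k \<delta> + miss_prob k \<delta>"
    using bias_div_le by (simp add: hit_prob_def miss_prob_def)
  also have "\<dots> \<le> (?p + ?r)\<^sup>2"
    using sqrt_sq miss_prob_le_hit_prob miss_prob_nonneg by (simp add: power2_sum)
  finally have "noise_hellinger k \<delta> * (2 / real k) \<le> (?p - ?r)\<^sup>2 * (?p + ?r)\<^sup>2"
    unfolding noise_hellinger_def by (rule mult_left_mono) simp
  also have "\<dots> = (?p\<^sup>2 - ?r\<^sup>2)\<^sup>2"
    by algebra
  also have "\<dots> \<le> (2 * \<delta>)\<^sup>2"
    unfolding sqrt_sq using hit_prob_diff_miss_prob_le miss_prob_le_hit_prob
    by (intro power_mono) simp_all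
  finally show ?thesis using k_ge_2 by (simp add: field_simps)
qed

lemma pmf_answer_pmf:
  assumes "a < k"
  shows "pmf (answer_pmf k \<delta> g e) a =
    (if int a = label_diff g e mod int k then hit_prob k \<delta> else miss_prob k \<delta>)"
proof -
  define b where "b = nat ((int a - label_diff g e) mod int k)"
  have b: "int b = (int a - label_diff g e) mod int k" "b < k"
    using k_ge_2 by (auto simp: b_def nat_less_iff)
  have supp: "set_pmf (noise_pmf k \<delta>) \<subseteq> {..<k}"
    using k_ge_2 bias_nonneg bias_le by (auto simp: set_pmf_iff pmf_noise_pmf split: if_splits)
  have measurement_eq_iff: "measurement k g (\<lambda>_. \<eta>) e = a \<longleftrightarrow> \<eta> = b" if "\<eta> < k" for \<eta>
  proof -
    have "measurement k g (\<lambda>_. \<eta>) e = a \<longleftrightarrow> (label_diff g e + int \<eta>) mod int k = int a mod int k"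
      using assms by (auto simp: measurement_eq_label_diff nat_eq_iff)
    also have "\<dots> \<longleftrightarrow> int \<eta> mod int k = (int a - label_diff g e) mod int k"
      unfolding mod_eq_dvd_iff by (simp add: algebra_simps)
    also have "\<dots> \<longleftrightarrow> \<eta> = b"
      using that b by auto
    finally show ?thesis .
  qed
  have "pmf (answer_pmf k \<delta> g e) a = measure_pmf.prob (noise_pmf k \<delta>) {b}"
    unfolding answer_pmf_def pmf_map
    using supp measurement_eq_iff b(2)
    by (intro measure_pmf.finite_measure_eq_AE) (auto simp: AE_measure_pmf_iff)
  also have "\<dots> = pmf (noise_pmf k \<delta>) b"
    by (simp add: measure_pmf_single)
  also have "b = 0 \<longleftrightarrow> int a mod int k = label_diff g e mod int k"
    unfolding mod_eq_dvd_iff using b(1) by (metis dvd_eq_mod_eq_0 of_nat_0_eq_iff)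
  then have "pmf (noise_pmf k \<delta>) b =
      (if int a = label_diff g e mod int k then hit_prob k \<delta> else miss_prob k \<delta>)"
    using assms b k_ge_2 bias_nonneg bias_le by (simp add: pmf_noise_pmf hit_prob_def miss_prob_def)
  finally show ?thesis .
qed

lemma set_answer_pmf: "set_pmf (answer_pmf k \<delta> g e) \<subseteq> {..<k}"
  using k_ge_2 by (auto simp: answer_pmf_def measurement_eq_label_diff nat_less_iff)

lemma bhattacharyya_answer_pmf_self:
  "bhattacharyya {..<k} (pmf (answer_pmf k \<delta> g e)) (pmf (answer_pmf k \<delta> g e)) = 1"
  by (simp add: bhattacharyya_self sum_pmf_eq_1 set_answer_pmf)

lemma bhattacharyya_answer_pmf:
  assumes "label_diff g e mod int k \<noteq> label_diff g' e mod int k"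
  shows "bhattacharyya {..<k} (pmf (answer_pmf k \<delta> g e)) (pmf (answer_pmf k \<delta> g' e)) =
    1 - noise_hellinger k \<delta>"
proof -
  let ?p = "hit_prob k \<delta>" and ?r = "miss_prob k \<delta>"
  let ?s = "\<lambda>a. sqrt (pmf (answer_pmf k \<delta> g e) a * pmf (answer_pmf k \<delta> g' e) a)"
  define c d where "c = nat (label_diff g e mod int k)" and "d = nat (label_diff g' e mod int k)"
  have residues: "int c = label_diff g e mod int k" "int d = label_diff g' e mod int k"
    "c < k" "d < k"
    using k_ge_2 by (auto simp: c_def d_def nat_less_iff)
  then have "c \<noteq> d" using assms by auto
  have sqrt_eq: "?s a = (if a \<in> {c, d} then sqrt (?p * ?r) else ?r)" if "a < k" for a
    using that \<open>c \<noteq> d\<close> miss_prob_nonneg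
    by (auto simp: pmf_answer_pmf mult.commute[of ?r ?p] simp flip: residues(1,2))
  have "bhattacharyya {..<k} (pmf (answer_pmf k \<delta> g e)) (pmf (answer_pmf k \<delta> g' e))
      = (\<Sum>a\<in>{..<k} - {c, d}. ?s a) + (\<Sum>a\<in>{c, d}. ?s a)"
    unfolding bhattacharyya_def using residues by (intro sum.subset_diff) auto
  also have "(\<Sum>a\<in>{..<k} - {c, d}. ?s a) = (\<Sum>a\<in>{..<k} - {c, d}. ?r)"
    using sqrt_eq by (intro sum.cong) auto
  also have "\<dots> = (real k - 2) * ?r"
    using residues \<open>c \<noteq> d\<close> k_ge_2 by (simp add: card_Diff_subset of_nat_diff)
  also have "(\<Sum>a\<in>{c, d}. ?s a) = 2 * (sqrt ?p * sqrt ?r)"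
    using sqrt_eq residues \<open>c \<noteq> d\<close> by (simp add: real_sqrt_mult)
  also have "(real k - 2) * ?r + 2 * (sqrt ?p * sqrt ?r) = 1 - noise_hellinger k \<delta>"
    using hit_prob_add_miss_probs miss_prob_nonneg miss_prob_le_hit_prob
    by (simp add: noise_hellinger_def power2_diff algebra_simps)
  finally show ?thesis .
qed

lemma set_answers_pmf: "set_pmf (answers_pmf k \<delta> g Q) \<subseteq> PiE Q (\<lambda>_. {..<k})"
  using k_ge_2 by (auto simp: answers_pmf_def measurement_eq_label_diff nat_less_iff)

lemma pmf_answers_pmf:
  assumes "finite Q" "f \<in> PiE Q (\<lambda>_. {..<k})"
  shows "pmf (answers_pmf k \<delta> g Q) f = (\<Prod>e\<in>Q. pmf (answer_pmf k \<delta> g e) (f e))"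
  using assms by (simp add: answers_pmf_eq_Pi_pmf) (rule pmf_Pi', auto)

end

subsection \<open>Recovering the labels on an independent set\<close>

lemma valid_queries_finite: "valid_queries n Q \<Longrightarrow> finite Q"
  by (rule finite_subset[of _ "{1..n} \<times> {1..n}"]) (auto simp: valid_queries_def)

lemma valid_queries_irrefl: "valid_queries n Q \<Longrightarrow> irrefl Q"
  by (auto simp: valid_queries_def irrefl_def)

lemma ex_low_degree_independent_set:
  assumes "valid_queries n Q" and "0 < D" "4 * real (card Q) \<le> real n * D"
  obtains S where "S \<subseteq> {1..n}" "independent_set Q S" "\<And>v. v \<in> S \<Longrightarrow> real (card (incident Q v)) \<le> D"
    "real n \<le> 2 * real (card S) * (D + 1)"
proof -
  let ?T = "{v \<in> {1..n}. real (card (incident Q v)) \<le> D}"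
  obtain S where S: "S \<subseteq> ?T" "independent_set Q S" "real (card ?T) \<le> real (card S) * (D + 1)"
    by (rule ex_large_independent_set[OF valid_queries_finite valid_queries_irrefl, of n Q n ?T D])
       (use assms(1) in auto)
  have "real n \<le> 2 * real (card ?T)"
    using card_low_degree_ge[of Q "{1..n}" D] valid_queries_finite[OF assms(1)] assms(2,3) by simp
  also have "\<dots> \<le> 2 * real (card S) * (D + 1)" using S(3) by simp
  finally show thesis using S(1,2) by (intro that[of S]) auto
qed

definition recovery_prob ::
  "nat \<Rightarrow> nat \<Rightarrow> real \<Rightarrow> (nat \<times> nat) set \<Rightarrow> ((nat \<times> nat \<Rightarrow> nat) \<Rightarrow> (nat \<Rightarrow> nat) pmf) \<Rightarrow> (nat \<Rightarrow> nat) \<Rightarrow> real"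
where
  "recovery_prob n k \<delta> Q d g =
     measure_pmf.prob (bind_pmf (answers_pmf k \<delta> g Q) d) {h. equal_up_to_shift n k g h}"

lemma card_equal_up_to_shift_le:
  assumes "G \<subseteq> PiE {1..n} (\<lambda>_. {..<k})"
  shows "card {g \<in> G. equal_up_to_shift n k g h} \<le> k"
proof -
  have "{g \<in> G. equal_up_to_shift n k g h} \<subseteq> (\<lambda>\<alpha>. \<lambda>v\<in>{1..n}. (h v + (k - \<alpha>)) mod k) ` {..<k}"
  proof clarify
    fix g assume "g \<in> G" "equal_up_to_shift n k g h"
    then obtain \<alpha> where \<alpha>: "\<alpha> < k" "\<And>v. v \<in> {1..n} \<Longrightarrow> h v = (g v + \<alpha>) mod k"
      by (auto simp: equal_up_to_shift_def)
    have g: "g \<in> PiE {1..n} (\<lambda>_. {..<k})" using \<open>g \<in> G\<close> assms by blast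
    have "(h v + (k - \<alpha>)) mod k = g v" if "v \<in> {1..n}" for v
      using \<alpha>(1) PiE_mem[OF g that] unfolding \<alpha>(2)[OF that] mod_add_left_eq by simp
    then have "(\<lambda>v\<in>{1..n}. (h v + (k - \<alpha>)) mod k) = g"
      using g by (intro PiE_ext[of _ "{1..n}" "\<lambda>_. {..<k}"]) (auto simp: restrict_PiE_iff)
    then show "g \<in> (\<lambda>\<alpha>. \<lambda>v\<in>{1..n}. (h v + (k - \<alpha>)) mod k) ` {..<k}"
      using \<alpha>(1) by blast
  qed
  then have "card {g \<in> G. equal_up_to_shift n k g h} \<le> card {..<k}"
    by (intro surj_card_le) auto
  then show ?thesis by simp
qed

locale two_label_family = alignment_noise +
  fixes n :: nat and Q :: "(nat \<times> nat) set" and a b :: "nat \<Rightarrow> nat"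
  assumes valid: "valid_queries n Q"
    and labels_less: "v \<in> {1..n} \<Longrightarrow> a v < k" "v \<in> {1..n} \<Longrightarrow> b v < k"
    and independent: "independent_set Q {v \<in> {1..n}. a v \<noteq> b v}"
begin

definition undetermined :: "nat set" where
  "undetermined = {v \<in> {1..n}. a v \<noteq> b v}"

text \<open>
  The owner of a query is its only endpoint whose label can be undetermined, so that the law of the
  answer depends on the label of the owner alone.
\<close>

definition owner :: "nat \<times> nat \<Rightarrow> nat" where
  "owner e = (if fst e \<in> undetermined then fst e else snd e)"

definition flip_owner :: "nat \<times> nat \<Rightarrow> nat \<Rightarrow> nat" where
  "flip_owner e = a(owner e := b (owner e))"

definition max_likelihood :: "(nat \<times> nat \<Rightarrow> nat) \<Rightarrow> real" where
  "max_likelihood f = (\<Prod>v\<in>{1..n}.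
     max (\<Prod>e | e \<in> Q \<and> owner e = v. pmf (answer_pmf k \<delta> a e) (f e))
         (\<Prod>e | e \<in> Q \<and> owner e = v. pmf (answer_pmf k \<delta> (flip_owner e) e) (f e)))"

lemma query_endpoints: "e \<in> Q \<Longrightarrow> fst e \<in> {1..n} \<and> snd e \<in> {1..n} \<and> fst e \<noteq> snd e"
  using valid by (auto simp: valid_queries_def)

lemma finite_Q: "finite Q"
  using valid by (rule valid_queries_finite)

lemma owner_fibre_undetermined:
  assumes "v \<in> undetermined"
  shows "{e \<in> Q. owner e = v} = incident Q v"
  using assms independent
  by (auto simp: independent_set_def undetermined_def owner_def incident_def)

lemma owner_in_vertices: "owner \<in> Q \<rightarrow> {1..n}"
  using query_endpoints by (auto simp: owner_def)

lemma answer_pmf_eq_update_owner: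
  assumes g: "g \<in> PiE {1..n} (\<lambda>v. {a v, b v})" and "e \<in> Q"
  shows "answer_pmf k \<delta> g e = answer_pmf k \<delta> (a(owner e := g (owner e))) e"
proof -
  have "g v = a v" if "v \<in> {1..n} - undetermined" for v
    using PiE_mem[OF g, of v] that by (auto simp: undetermined_def)
  moreover have "fst e \<notin> undetermined \<or> snd e \<notin> undetermined"
    using independent \<open>e \<in> Q\<close> by (cases e) (auto simp: independent_set_def undetermined_def)
  ultimately show ?thesis
    using query_endpoints[OF \<open>e \<in> Q\<close>] by (intro answer_pmf_cong) (auto simp: owner_def)
qed

lemma pmf_answers_pmf_le_max_likelihood:
  assumes g: "g \<in> PiE {1..n} (\<lambda>v. {a v, b v})" and f: "f \<in> PiE Q (\<lambda>_. {..<k})"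
  shows "pmf (answers_pmf k \<delta> g Q) f \<le> max_likelihood f"
proof -
  have "pmf (answers_pmf k \<delta> g Q) f = (\<Prod>e\<in>Q. pmf (answer_pmf k \<delta> g e) (f e))"
    using finite_Q f by (rule pmf_answers_pmf)
  also have "\<dots> = (\<Prod>v\<in>{1..n}. \<Prod>e | e \<in> Q \<and> owner e = v. pmf (answer_pmf k \<delta> g e) (f e))"
    using finite_Q owner_in_vertices by (intro prod.group[symmetric]) auto
  also have "\<dots> \<le> max_likelihood f"
    unfolding max_likelihood_def
  proof (intro prod_mono conjI prod_nonneg)
    fix v assume v: "v \<in> {1..n}"
    have "(\<Prod>e | e \<in> Q \<and> owner e = v. pmf (answer_pmf k \<delta> g e) (f e)) =
        (\<Prod>e | e \<in> Q \<and> owner e = v. pmf (answer_pmf k \<delta> (a(v := g v)) e) (f e))"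
      using answer_pmf_eq_update_owner[OF g] by (intro prod.cong) auto
    moreover have "(\<Prod>e | e \<in> Q \<and> owner e = v. pmf (answer_pmf k \<delta> (flip_owner e) e) (f e)) =
        (\<Prod>e | e \<in> Q \<and> owner e = v. pmf (answer_pmf k \<delta> (a(v := b v)) e) (f e))"
      by (intro prod.cong) (auto simp: flip_owner_def)
    moreover have "g v = a v \<or> g v = b v" using PiE_mem[OF g v] by simp
    ultimately show "(\<Prod>e | e \<in> Q \<and> owner e = v. pmf (answer_pmf k \<delta> g e) (f e)) \<le>
        max (\<Prod>e | e \<in> Q \<and> owner e = v. pmf (answer_pmf k \<delta> a e) (f e))
            (\<Prod>e | e \<in> Q \<and> owner e = v. pmf (answer_pmf k \<delta> (flip_owner e) e) (f e))"
      by auto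
  qed simp
  finally show ?thesis .
qed

lemma bhattacharyya_flip_owner:
  assumes "e \<in> Q"
  shows "bhattacharyya {..<k} (pmf (answer_pmf k \<delta> a e)) (pmf (answer_pmf k \<delta> (flip_owner e) e)) =
    (if owner e \<in> undetermined then 1 - noise_hellinger k \<delta> else 1)"
proof (cases "owner e \<in> undetermined")
  case True
  then have "a (owner e) mod k \<noteq> b (owner e) mod k"
    using labels_less by (auto simp: undetermined_def)
  then have "\<not> int k dvd int (a (owner e)) - int (b (owner e))"
    "\<not> int k dvd int (b (owner e)) - int (a (owner e))"
    by (simp_all add: mod_eq_dvd_iff[symmetric] flip: of_nat_mod)
  then have "label_diff a e mod int k \<noteq> label_diff (flip_owner e) e mod int k"
    using query_endpoints[OF assms]
    by (auto simp: mod_eq_dvd_iff label_diff_def flip_owner_def owner_def split: if_splits)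
  from bhattacharyya_answer_pmf[OF this] True show ?thesis by simp
next
  case False
  then have "flip_owner e = a"
    using owner_in_vertices assms by (auto simp: flip_owner_def undetermined_def Pi_iff)
  with False show ?thesis by (simp add: bhattacharyya_answer_pmf_self)
qed

lemma sum_max_likelihood_le:
  "(\<Sum>f\<in>PiE Q (\<lambda>_. {..<k}). max_likelihood f)
    \<le> (\<Prod>v\<in>undetermined. 2 * guess_bound k \<delta> (card (incident Q v)))"
proof -
  let ?\<beta> = "\<lambda>e. bhattacharyya {..<k}
    (pmf (answer_pmf k \<delta> a e)) (pmf (answer_pmf k \<delta> (flip_owner e) e))"
  have "(\<Sum>f\<in>PiE Q (\<lambda>_. {..<k}). max_likelihood f)
      \<le> (\<Prod>v\<in>{1..n}. 1 + sqrt (1 - (\<Prod>e | e \<in> Q \<and> owner e = v. ?\<beta> e)\<^sup>2))"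
    unfolding max_likelihood_def
    using finite_Q owner_in_vertices set_answer_pmf by (intro sum_prod_max_pmf_le) auto
  also have "\<dots> = (\<Prod>v\<in>undetermined. 1 + sqrt (1 - (\<Prod>e | e \<in> Q \<and> owner e = v. ?\<beta> e)\<^sup>2))"
    by (intro prod.mono_neutral_right) (auto simp: bhattacharyya_flip_owner undetermined_def)
  also have "\<dots> = (\<Prod>v\<in>undetermined. 2 * guess_bound k \<delta> (card (incident Q v)))"
    by (intro prod.cong refl)
       (simp add: bhattacharyya_flip_owner guess_bound_def mult.commute
             flip: owner_fibre_undetermined power_mult)
  finally show ?thesis .
qed

lemma sum_recovery_prob_le:
  "(\<Sum>g\<in>PiE {1..n} (\<lambda>v. {a v, b v}). recovery_prob n k \<delta> Q d g)
    \<le> real k * (\<Prod>v\<in>undetermined. 2 * guess_bound k \<delta> (card (incident Q v)))"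
proof -
  have labels_subset: "PiE {1..n} (\<lambda>v. {a v, b v}) \<subseteq> PiE {1..n} (\<lambda>_. {..<k})"
    using labels_less by (intro PiE_mono) auto
  have "(\<Sum>g\<in>PiE {1..n} (\<lambda>v. {a v, b v}). recovery_prob n k \<delta> Q d g)
      \<le> real k * (\<Sum>f\<in>PiE Q (\<lambda>_. {..<k}). max_likelihood f)"
    unfolding recovery_prob_def
    using pmf_answers_pmf_le_max_likelihood card_equal_up_to_shift_le[OF labels_subset]
      set_answers_pmf finite_Q
    by (intro sum_prob_bind_pmf_le)
       (auto simp: finite_PiE max_likelihood_def intro!: prod_nonneg max.coboundedI1)
  also have "\<dots> \<le> real k * (\<Prod>v\<in>undetermined. 2 * guess_bound k \<delta> (card (incident Q v)))"
    by (intro mult_left_mono sum_max_likelihood_le) simp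
  finally show ?thesis .
qed

end

lemma (in alignment_noise) sum_recovery_prob_binary_le:
  assumes valid: "valid_queries n Q" and S: "S \<subseteq> {1..n}" "independent_set Q S"
  shows "(\<Sum>g\<in>PiE {1..n} (\<lambda>_. {..<2}). recovery_prob n k \<delta> Q d g)
    \<le> 2 ^ n * (real k * (\<Prod>v\<in>S. guess_bound k \<delta> (card (incident Q v))))"
proof -
  let ?T = "{1..n} - S"
  let ?G = "\<lambda>u. PiE {1..n} (\<lambda>v. if v \<in> ?T then {u v} else {..<2::nat})"
  define C where "C = (\<Prod>v\<in>S. guess_bound k \<delta> (card (incident Q v)))"
  have fibre: "(\<Sum>g\<in>?G u. recovery_prob n k \<delta> Q d g) \<le> real k * (2 ^ card S * C)"
    if u: "u \<in> PiE ?T (\<lambda>_. {..<2})" for u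
  proof -
    define a b where "a v = (if v \<in> S then 0 else u v)" and "b v = (if v \<in> S then 1 else u v)" for v
    have undetermined_eq: "{v \<in> {1..n}. a v \<noteq> b v} = S"
      using S(1) by (auto simp: a_def b_def)
    have "a v < 2" "b v < 2" if "v \<in> {1..n}" for v
      using PiE_mem[OF u, of v] that by (auto simp: a_def b_def)
    then interpret two_label_family k \<delta> n Q a b
      using valid S(2) order_less_le_trans[OF _ k_ge_2]
      by unfold_locales (simp_all only: undetermined_eq)
    have "?G u = PiE {1..n} (\<lambda>v. {a v, b v})"
      by (intro PiE_cong) (auto simp: a_def b_def)
    then show ?thesis
      using sum_recovery_prob_le[of d]
      by (simp only: undetermined_def undetermined_eq C_def prod.distrib prod_constant)
  qed
  have "(\<Sum>g\<in>PiE {1..n} (\<lambda>_. {..<2}). recovery_prob n k \<delta> Q d g) =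
      (\<Sum>u\<in>PiE ?T (\<lambda>_. {..<2}). \<Sum>g\<in>?G u. recovery_prob n k \<delta> Q d g)"
    by (rule sum_PiE_split) auto
  also have "\<dots> \<le> (\<Sum>u\<in>PiE ?T (\<lambda>_. {..<2::nat}). real k * (2 ^ card S * C))"
    by (intro sum_mono fibre)
  also have "\<dots> = 2 ^ (n - card S) * (real k * (2 ^ card S * C))"
    using finite_subset[OF S(1)] S(1) by (simp add: card_PiE card_Diff_subset)
  also have "\<dots> = 2 ^ n * (real k * C)"
    using card_mono[OF _ S(1)] by (simp add: power_diff)
  finally show ?thesis by (simp only: C_def)
qed

subsection \<open>Success probability of an algorithm\<close>

definition success_probability_at_most :: "nat \<Rightarrow> nat \<Rightarrow> real \<Rightarrow> nat \<Rightarrow> real \<Rightarrow> bool" where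
  "success_probability_at_most n k \<delta> m c \<longleftrightarrow>
     (\<forall>A \<epsilon>. makes_at_most_queries n A m \<and> has_success_probability n k \<delta> A \<epsilon> \<longrightarrow> \<epsilon> \<le> c)"

lemma success_probability_at_most_mono:
  "success_probability_at_most n k \<delta> m c \<Longrightarrow> c \<le> c' \<Longrightarrow> success_probability_at_most n k \<delta> m c'"
  unfolding success_probability_at_most_def by (meson order_trans)

lemma prob_output_pmf:
  "measure_pmf.prob (output_pmf k \<delta> A g) {h. equal_up_to_shift n k g h} =
    measure_pmf.expectation (query_dist A) (\<lambda>Q. recovery_prob n k \<delta> Q (decoder A Q) g)"
  unfolding output_pmf_def recovery_prob_def by (rule prob_bind_pmf)

text \<open>Yao's principle: the average over \<open>G\<close> lets the random query set be fixed.\<close>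

lemma success_probability_at_mostI:
  assumes G: "finite G" "G \<noteq> {}" "G \<subseteq> {1..n} \<rightarrow> {..<k}"
    and average_le: "\<And>Q d. valid_queries n Q \<Longrightarrow> card Q \<le> m \<Longrightarrow>
      (\<Sum>g\<in>G. recovery_prob n k \<delta> Q d g) \<le> real (card G) * c"
  shows "success_probability_at_most n k \<delta> m c"
  unfolding success_probability_at_most_def
proof (intro allI impI, elim conjE)
  fix A \<epsilon> assume A: "makes_at_most_queries n A m" "has_success_probability n k \<delta> A \<epsilon>"
  let ?P = "\<lambda>g Q. recovery_prob n k \<delta> Q (decoder A Q) g"
  have integrable: "integrable (query_dist A) (?P g)" for g
    by (rule measure_pmf.integrable_const_bound[where B = 1]) (auto simp: recovery_prob_def)
  have "real (card G) * \<epsilon> = (\<Sum>g\<in>G. \<epsilon>)"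
    by simp
  also have "\<dots> \<le> (\<Sum>g\<in>G. measure_pmf.expectation (query_dist A) (?P g))"
    using A(2) G(3)
    by (intro sum_mono) (auto simp: has_success_probability_def simp flip: prob_output_pmf)
  also have "\<dots> = measure_pmf.expectation (query_dist A) (\<lambda>Q. \<Sum>g\<in>G. ?P g Q)"
    using integrable by (intro Bochner_Integration.integral_sum[symmetric])
  also have "\<dots> \<le> real (card G) * c"
    using A(1) average_le integrable
    by (intro measure_pmf.integral_le_const)
       (auto simp: AE_measure_pmf_iff makes_at_most_queries_def)
  finally show "\<epsilon> \<le> c"
    using G by (simp add: card_gt_0_iff)
qed

lemma (in alignment_noise) success_probability_at_most_exp:
  assumes "noise_hellinger k \<delta> \<le> 1 / 2" and D: "0 < D" "4 * real m \<le> real n * D"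
  shows "success_probability_at_most n k \<delta> m
    (real k * exp (- (real n / (8 * (D + 1)) * exp (- (4 * noise_hellinger k \<delta> * D)))))"
    (is "success_probability_at_most n k \<delta> m (real k * ?bound)")
proof (rule success_probability_at_mostI[where G = "PiE {1..n} (\<lambda>_. {..<2})"])
  show "PiE {1..n} (\<lambda>_. {..<2}) \<subseteq> {1..n} \<rightarrow> {..<k}"
    using k_ge_2 by (auto simp: PiE_iff intro: less_le_trans)
  fix Q d assume Q: "valid_queries n Q" "card Q \<le> m"
  have "4 * real (card Q) \<le> real n * D"
    using Q(2) D(2) by simp
  with Q(1) D(1) obtain S where S: "S \<subseteq> {1..n}" "independent_set Q S"
    and degree: "\<And>v. v \<in> S \<Longrightarrow> real (card (incident Q v)) \<le> D"
    and card: "real n \<le> 2 * real (card S) * (D + 1)"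
    using ex_low_degree_independent_set by blast
  have size: "real n / (8 * (D + 1)) \<le> real (card S) / 4"
    using card D(1) by (simp add: field_simps)
  have "(\<Prod>v\<in>S. guess_bound k \<delta> (card (incident Q v)))
      \<le> exp (- (real (card S) / 4 * exp (- (4 * noise_hellinger k \<delta> * D))))"
    unfolding guess_bound_def using noise_hellinger_nonneg assms(1) degree
    by (rule prod_half_one_plus_sqrt_le_exp)
  also have "\<dots> \<le> ?bound"
    unfolding exp_le_cancel_iff neg_le_iff_le using size by (rule mult_right_mono) simp
  finally have "(\<Sum>g\<in>PiE {1..n} (\<lambda>_. {..<2}). recovery_prob n k \<delta> Q d g) \<le> 2 ^ n * (real k * ?bound)"
    by (intro order_trans[OF sum_recovery_prob_binary_le[OF Q(1) S]] mult_left_mono) simp_all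
  then show "(\<Sum>g\<in>PiE {1..n} (\<lambda>_. {..<2}). recovery_prob n k \<delta> Q d g) \<le>
      real (card (PiE {1..n} (\<lambda>_. {..<2::nat}))) * (real k * ?bound)"
    by (simp add: card_PiE)
qed (auto simp: finite_PiE PiE_eq_empty_iff lessThan_empty_iff)

text \<open>
  The lower bound on the rate keeps the degree threshold \<open>ln n / (128 r)\<close> below \<open>n^(1/2) ln n\<close>.
\<close>

definition information_rate :: "nat \<Rightarrow> nat \<Rightarrow> real \<Rightarrow> real \<Rightarrow> bool" where
  "information_rate n k \<delta> r \<longleftrightarrow> alignment_noise k \<delta> \<and>
     noise_hellinger k \<delta> \<le> 2 * r \<and> real n powr (- 1 / 2) \<le> 2 * r \<and> r \<le> 1 / 4"

lemma information_rate_pos: "information_rate n k \<delta> r \<Longrightarrow> 0 < n \<Longrightarrow> 0 < r"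
  using powr_gt_zero[of "real n" "- 1 / 2"] unfolding information_rate_def by linarith

lemma alignment_noiseI:
  assumes "2 \<le> k" "0 \<le> \<delta>" "\<delta> \<le> 1 / 4"
  shows "alignment_noise k \<delta>"
proof
  have "1 / 4 \<le> 1 - 1 / real k" using assms(1) by (simp add: field_simps)
  then show "\<delta> \<le> 1 - 1 / real k" using assms(3) by simp
qed (use assms in auto)

lemma information_rate_small_bias:
  assumes "2 \<le> k" "real n powr (- 1 / 4) \<le> \<delta>" "\<delta> \<le> 1 / (2 * real k)"
  shows "information_rate n k \<delta> (\<delta>\<^sup>2 * real k)"
proof -
  have "0 \<le> \<delta>" using assms(2) by (rule order_trans[rotated]) simp
  have "1 / (2 * real k) \<le> 1 / 4" using assms(1) by (intro divide_left_mono) auto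
  then have "\<delta> \<le> 1 / 4" using assms(3) by simp
  then interpret alignment_noise k \<delta>
    using assms(1) \<open>0 \<le> \<delta>\<close> by (intro alignment_noiseI)
  have "real n powr (- 1 / 2) = (real n powr (- 1 / 4))\<^sup>2"
    by (simp add: power2_eq_square flip: powr_add)
  also have "\<dots> \<le> \<delta>\<^sup>2"
    using assms(2) by (intro power_mono) auto
  also have "\<dots> \<le> \<delta>\<^sup>2 * (2 * real k)"
    using assms(1) by (intro mult_le_cancel_left1[THEN iffD2]) auto
  finally have lower: "real n powr (- 1 / 2) \<le> 2 * (\<delta>\<^sup>2 * real k)"
    by simp
  have "\<delta> * real k \<le> 1 / 2"
    using assms(1,3) by (simp add: field_simps)
  then have "\<delta> * (\<delta> * real k) \<le> 1 / 4 * (1 / 2)"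
    using \<open>0 \<le> \<delta>\<close> \<open>\<delta> \<le> 1 / 4\<close> by (intro mult_mono) auto
  then have "\<delta>\<^sup>2 * real k \<le> 1 / 4"
    by (simp add: power2_eq_square)
  then show ?thesis
    using alignment_noise_axioms noise_hellinger_le_bias_squared lower
    by (simp add: information_rate_def)
qed

lemma information_rate_large_bias:
  assumes "2 \<le> k" "real k \<le> real n powr (1 / 2)" "1 / (2 * real k) \<le> \<delta>" "\<delta> \<le> 1 / 4"
  shows "information_rate n k \<delta> \<delta>"
proof -
  have "0 \<le> \<delta>" using assms(3) by (rule order_trans[rotated]) simp
  then interpret alignment_noise k \<delta>
    using assms(1,4) by (intro alignment_noiseI)
  have "real n powr (- 1 / 2) = 1 / real n powr (1 / 2)"
    by (simp add: powr_minus_divide)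
  also have "\<dots> \<le> 1 / real k"
    using assms(1,2)
    by (intro divide_left_mono) (auto intro!: mult_pos_pos order_less_le_trans[OF _ assms(2)])
  also have "\<dots> \<le> 2 * \<delta>"
    using assms(1,3) by (simp add: field_simps)
  finally show ?thesis
    using alignment_noise_axioms noise_hellinger_le_bias assms(4)
    by (simp add: information_rate_def)
qed

definition error_exponent :: "nat \<Rightarrow> real" where
  "error_exponent n =
     real n / (8 * (ln (real n) * real n powr (1 / 2) / 64 + 1)) * real n powr (- 1 / 16)"

lemma success_probability_at_most_information_rate:
  assumes rate: "information_rate n k \<delta> r"
    and queries: "real m \<le> real n * ln (real n) / (512 * r)" and "2 \<le> n"
  shows "success_probability_at_most n k \<delta> m (real k * exp (- error_exponent n))"
proof -
  interpret alignment_noise k \<delta> using rate by (simp add: information_rate_def)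
  have hellinger: "noise_hellinger k \<delta> \<le> 2 * r" "noise_hellinger k \<delta> \<le> 1 / 2"
    and r_ge: "real n powr (- 1 / 2) \<le> 2 * r" and "0 < r"
    using rate information_rate_pos[OF rate] \<open>2 \<le> n\<close> by (simp_all add: information_rate_def)
  define D where "D = ln (real n) / (128 * r)"
  have "0 < D" using \<open>0 < r\<close> \<open>2 \<le> n\<close> by (simp add: D_def)
  have "1 / (2 * r) \<le> 1 / real n powr (- 1 / 2)"
    using r_ge \<open>0 < r\<close> \<open>2 \<le> n\<close> by (intro divide_left_mono) auto
  also have "\<dots> = real n powr (1 / 2)"
    by (simp add: powr_minus_divide)
  finally have "ln (real n) / 64 * (1 / (2 * r)) \<le> ln (real n) / 64 * real n powr (1 / 2)"
    using \<open>2 \<le> n\<close> by (intro mult_left_mono) auto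
  then have D_le: "D \<le> ln (real n) * real n powr (1 / 2) / 64"
    by (simp add: D_def)
  have "4 * noise_hellinger k \<delta> * D \<le> 4 * (2 * r) * D"
    using hellinger(1) \<open>0 < D\<close> by (intro mult_right_mono) auto
  also have "\<dots> = ln (real n) / 16"
    using \<open>0 < r\<close> by (simp add: D_def)
  finally have "real n powr (- 1 / 16) \<le> exp (- (4 * noise_hellinger k \<delta> * D))"
    using \<open>2 \<le> n\<close> by (simp add: powr_def)
  then have "error_exponent n \<le> real n / (8 * (D + 1)) * exp (- (4 * noise_hellinger k \<delta> * D))"
    unfolding error_exponent_def using D_le \<open>0 < D\<close> by (intro mult_mono divide_left_mono) auto
  moreover have "4 * real m \<le> real n * D"
    using queries \<open>0 < r\<close> by (simp add: D_def field_simps)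
  ultimately show ?thesis
    using success_probability_at_most_mono[OF success_probability_at_most_exp]
      hellinger(2) \<open>0 < D\<close> by (simp add: mult_left_mono)
qed

lemma eventually_success_probability_at_most:
  assumes rate: "\<forall>\<^sub>F n in sequentially. information_rate n (k n) (\<delta> n) (r n)"
    and k: "\<forall>\<^sub>F n in sequentially. real (k n) \<le> real n"
    and q: "(\<lambda>n. real (q n)) \<in> o(\<lambda>n. real n * ln (real n) / r n)"
  shows "\<exists>c>0. \<forall>\<^sub>F n in sequentially.
    success_probability_at_most n (k n) (\<delta> n) (q n) (exp (- (real n powr c)))"
proof -
  have few_queries:
    "\<forall>\<^sub>F n in sequentially. norm (real (q n)) \<le> 1 / 512 * norm (real n * ln (real n) / r n)"
    by (rule landau_o.smallD[OF q]) simp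
  have exponent: "\<forall>\<^sub>F n in sequentially. real n powr (1 / 4) + ln (real n) \<le> error_exponent n"
    unfolding error_exponent_def by real_asymp
  have "\<forall>\<^sub>F n in sequentially.
      success_probability_at_most n (k n) (\<delta> n) (q n) (exp (- (real n powr (1 / 4))))"
    using rate k few_queries exponent eventually_ge_at_top[of 2]
  proof eventually_elim
    case (elim n)
    have "0 < r n"
      using information_rate_pos[OF elim(1)] elim(5) by simp
    then have "real (q n) \<le> real n * ln (real n) / (512 * r n)"
      using elim(3,5) by simp
    with elim(1) have
      "success_probability_at_most n (k n) (\<delta> n) (q n) (real (k n) * exp (- error_exponent n))"
      using elim(5) by (rule success_probability_at_most_information_rate)
    moreover have "real (k n) * exp (- error_exponent n) \<le> exp (- (real n powr (1 / 4)))"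
    proof -
      have "real (k n) * exp (- error_exponent n) \<le> real n * exp (- error_exponent n)"
        using elim(2) by (intro mult_right_mono) auto
      also have "\<dots> = exp (ln (real n) - error_exponent n)"
        using elim(5) by (simp add: exp_diff exp_minus field_simps)
      also have "\<dots> \<le> exp (- (real n powr (1 / 4)))"
        using elim(4) by simp
      finally show ?thesis .
    qed
    ultimately show ?case by (rule success_probability_at_most_mono)
  qed
  then show ?thesis by (intro exI[of _ "1 / 4"]) simp
qed

theorem theorem2:
  fixes k :: "nat \<Rightarrow> nat" and \<delta> :: "nat \<Rightarrow> real" and e :: "nat \<Rightarrow> real" and q :: "nat \<Rightarrow> nat"
  assumes k_ge_2: "\<forall>\<^sub>F n in sequentially. k n \<ge> 2"
    and e: "e \<in> o(\<lambda>_. 1)"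
    and k_le: "\<forall>\<^sub>F n in sequentially. real (k n) \<le> real n powr e n"
  shows
    "((\<forall>\<^sub>F n in sequentially. real n powr (- 1 / 4) \<le> \<delta> n \<and> \<delta> n \<le> 1 / (2 * real (k n)))
      \<and> (\<lambda>n. real (q n)) \<in> o(\<lambda>n. real n * ln (real n) / ((\<delta> n)\<^sup>2 * real (k n)))
      \<longrightarrow> (\<exists>c>0. \<forall>\<^sub>F n in sequentially. \<forall>A \<epsilon>.
             makes_at_most_queries n A (q n) \<and> has_success_probability n (k n) (\<delta> n) A \<epsilon>
             \<longrightarrow> \<epsilon> \<le> exp (- (real n powr c))))
     \<and>
     ((\<forall>\<^sub>F n in sequentially. 1 / (2 * real (k n)) \<le> \<delta> n \<and> \<delta> n \<le> 1 / 4)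
      \<and> (\<lambda>n. real (q n)) \<in> o(\<lambda>n. real n * ln (real n) / \<delta> n)
      \<longrightarrow> (\<exists>c>0. \<forall>\<^sub>F n in sequentially. \<forall>A \<epsilon>.
             makes_at_most_queries n A (q n) \<and> has_success_probability n (k n) (\<delta> n) A \<epsilon>
             \<longrightarrow> \<epsilon> \<le> exp (- (real n powr c))))"
proof -
  have k_le_sqrt: "\<forall>\<^sub>F n in sequentially. real (k n) \<le> real n powr (1 / 2)"
    using k_le eventually_powr_le_powr[OF e, of "1 / 2"] by (auto elim: eventually_elim2)
  have k_le_n: "\<forall>\<^sub>F n in sequentially. real (k n) \<le> real n"
    using k_le eventually_powr_le_powr[OF e, of 1] by (auto elim: eventually_elim2)
  show ?thesis
    unfolding success_probability_at_most_def[symmetric]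
  proof (intro conjI impI; elim conjE)
    assume \<delta>: "\<forall>\<^sub>F n in sequentially. real n powr (- 1 / 4) \<le> \<delta> n \<and> \<delta> n \<le> 1 / (2 * real (k n))"
      and q: "(\<lambda>n. real (q n)) \<in> o(\<lambda>n. real n * ln (real n) / ((\<delta> n)\<^sup>2 * real (k n)))"
    have "\<forall>\<^sub>F n in sequentially. information_rate n (k n) (\<delta> n) ((\<delta> n)\<^sup>2 * real (k n))"
      using k_ge_2 \<delta> by eventually_elim (auto intro: information_rate_small_bias)
    from eventually_success_probability_at_most[OF this k_le_n q]
    show "\<exists>c>0. \<forall>\<^sub>F n in sequentially.
        success_probability_at_most n (k n) (\<delta> n) (q n) (exp (- (real n powr c)))" .
  next
    assume \<delta>: "\<forall>\<^sub>F n in sequentially. 1 / (2 * real (k n)) \<le> \<delta> n \<and> \<delta> n \<le> 1 / 4"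
      and q: "(\<lambda>n. real (q n)) \<in> o(\<lambda>n. real n * ln (real n) / \<delta> n)"
    have "\<forall>\<^sub>F n in sequentially. information_rate n (k n) (\<delta> n) (\<delta> n)"
      using k_ge_2 k_le_sqrt \<delta> by eventually_elim (auto intro: information_rate_large_bias)
    from eventually_success_probability_at_most[OF this k_le_n q]
    show "\<exists>c>0. \<forall>\<^sub>F n in sequentially.
        success_probability_at_most n (k n) (\<delta> n) (q n) (exp (- (real n powr c)))" .
  qed
qed

end
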